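(* Let $m=2g$ with $g\ge1$, let $n\ge 1$, and let $\|\cdot\|$ be any norm on the space $\mathrm{M}(n,m;\mathbb{R})$ of real $n\times m$ matrices. There is a constant $C>0$ depending only on $m$ and $n$ such that the following holds. Let $b^{(i)}=(b^{(i)}_1,\dots,b^{(i)}_m)$, $i=1,\dots,n$, be vectors of $\mathbb{R}^m$ such that $b^{(1)},\dots,b^{(n)},\pi e_1,\dots,\pi e_m$ are linearly independent over $\mathbb{Q}$ in the vector space $\mathbb{R}^m$, where $e_1,\dots,e_m$ is the canonical basis of $\mathbb{R}^m$, and let $B\in\mathrm{M}(n,m;\mathbb{R})$ be the matrix whose $i$-th row is $b^{(i)}$. Let $A\in\mathrm{M}(n,m;\mathbb{R})$ be a real matrix and let $\varepsilon>0$. Then there is an element $K\in\mathrm{Sp}(2g,\mathbb{Z})$ such that $$\|A-BK\|<C\varepsilon \mod 2\pi .$$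
   Context: For a matrix $X\in\mathrm{M}(n,m;\mathbb{R})$, the expression $\|X\|<\delta \bmod 2\pi$ means that there is an integer matrix $H\in\mathrm{M}(n,m;\mathbb{Z})$ with $\|X-2\pi H\|<\delta$. $\mathrm{Sp}(2g,\mathbb{Z})$ is the group of integer $2g\times2g$ matrices $K$ with $KJK^t=J$, where $J$ is block diagonal with $g$ blocks $\begin{pmatrix}0&1\\-1&0\end{pmatrix}$. *)

theory Defs
  imports "HOL-Analysis.Analysis" "HOL-Library.Numeral_Type"
begin

definition rat_scale :: "rat \<Rightarrow> 'a::real_vector \<Rightarrow> 'a" where
  "rat_scale q v = of_rat q *\<^sub>R v"

lemma vector_space_rat_scale: "vector_space (rat_scale :: rat \<Rightarrow> 'a::real_vector \<Rightarrow> 'a)"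
  by unfold_locales (auto simp: rat_scale_def of_rat_add of_rat_mult algebra_simps)

text \<open>Independence of a family, not just of its range: repeated vectors are excluded.\<close>

definition rat_independent_family :: "('i \<Rightarrow> 'a::real_vector) \<Rightarrow> bool" where
  "rat_independent_family v \<longleftrightarrow> inj v \<and> module.independent rat_scale (range v)"

lemma rat_independent_family_iff:
  fixes v :: "'i::finite \<Rightarrow> 'a::real_vector"
  shows "rat_independent_family v \<longleftrightarrow>
    (\<forall>q. (\<Sum>i\<in>UNIV. rat_scale (q i) (v i)) = 0 \<longrightarrow> (\<forall>i. q i = 0))"
proof -
  interpret rat: vector_space "rat_scale :: rat \<Rightarrow> 'a \<Rightarrow> 'a"
    by (rule vector_space_rat_scale)
  show ?thesis
  proof
    assume "rat_independent_family v"
    then have inj: "inj v" and ind: "rat.independent (range v)"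
      by (auto simp: rat_independent_family_def)
    show "\<forall>q. (\<Sum>i\<in>UNIV. rat_scale (q i) (v i)) = 0 \<longrightarrow> (\<forall>i. q i = 0)"
    proof (intro allI impI)
      fix q i assume "(\<Sum>i\<in>UNIV. rat_scale (q i) (v i)) = 0"
      then have "(\<Sum>x\<in>range v. rat_scale (q (inv v x)) x) = 0"
        using inj by (simp add: sum.reindex)
      with ind have "q (inv v (v i)) = 0"
        using rat.independentD[of "range v" "range v" "\<lambda>x. q (inv v x)" "v i"] by auto
      then show "q i = 0" using inj by simp
    qed
  next
    assume *: "\<forall>q. (\<Sum>i\<in>UNIV. rat_scale (q i) (v i)) = 0 \<longrightarrow> (\<forall>i. q i = 0)"
    have inj: "inj v"
    proof (rule injI, rule ccontr)
      fix i j assume eq: "v i = v j" and ne: "i \<noteq> j"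
      let ?q = "\<lambda>k. if k = i then 1 else if k = j then -1 else (0::rat)"
      have "(\<Sum>k\<in>UNIV. rat_scale (?q k) (v k)) = (\<Sum>k\<in>{i,j}. rat_scale (?q k) (v k))"
        by (rule sum.mono_neutral_right) (auto simp: rat_scale_def)
      also have "\<dots> = 0" using ne eq by (simp add: rat_scale_def)
      finally show False using *[rule_format, of ?q i] by simp
    qed
    have "rat.independent (range v)"
    proof (rule rat.independent_if_scalars_zero)
      fix f x assume "(\<Sum>x\<in>range v. rat_scale (f x) x) = 0" "x \<in> range v"
      then show "f x = 0" using inj *[rule_format, of "f \<circ> v"] by (auto simp: sum.reindex)
    qed simp
    with inj show "rat_independent_family v" by (simp add: rat_independent_family_def)
  qed
qed

definition is_norm :: "('a::real_vector \<Rightarrow> real) \<Rightarrow> bool" where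
  "is_norm N \<longleftrightarrow>
     (\<forall>x. N x \<ge> 0) \<and> (\<forall>x. N x = 0 \<longleftrightarrow> x = 0) \<and>
     (\<forall>c x. N (c *\<^sub>R x) = \<bar>c\<bar> * N x) \<and> (\<forall>x y. N (x + y) \<le> N x + N y)"

abbreviation real_matrix :: "int ^ 'm ^ 'n \<Rightarrow> real ^ 'm ^ 'n" where
  "real_matrix \<equiv> map_matrix real_of_int"

definition norm_less_mod_2pi ::
    "(real ^ 'm ^ 'n \<Rightarrow> real) \<Rightarrow> real ^ 'm ^ 'n \<Rightarrow> real \<Rightarrow> bool" where
  "norm_less_mod_2pi N X \<delta> \<longleftrightarrow>
     (\<exists>H :: int ^ 'm ^ 'n. N (X - (2 * pi) *\<^sub>R real_matrix H) < \<delta>)"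

text \<open>Dimension \<open>2g\<close> is encoded by the index type \<open>'g \<times> 2\<close> with \<open>g = CARD('g)\<close>: the first
  component of an index names the diagonal block, the second the position inside that block.\<close>

definition symplectic_block :: "int ^ 2 ^ 2" where
  "symplectic_block = vector [vector [0, 1], vector [-1, 0]]"

definition symplectic_J :: "int ^ ('g::finite \<times> 2) ^ ('g \<times> 2)" where
  "symplectic_J = (\<chi> p q. if fst p = fst q then symplectic_block $ snd p $ snd q else 0)"

definition Sp_int :: "(int ^ ('g::finite \<times> 2) ^ ('g \<times> 2)) set" where
  "Sp_int = {K. K ** symplectic_J ** transpose K = symplectic_J}"

end

theory Submission
  imports Defs
begin

text \<open>After dividing by \<open>2\<pi>\<close>, let \<open>X\<close> be the closure of the orbit of \<open>B\<close> under the symplectic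
  group and integer translations. A symplectic transvection along an integer vector \<open>v\<close> sends
  \<open>x\<close> to \<open>x + t (x J v) v\<^sup>T\<close>, so \<open>X\<close> contains \<open>x + y v\<^sup>T\<close> for every \<open>y\<close> in the closure of the
  group generated by \<open>x J v\<close> and the integer vectors. By Baire's theorem a generic such \<open>y\<close> has
  \<open>c \<bullet> y\<close> outside any prescribed countable set for each integer \<open>c\<close> with \<open>c \<bullet> x J v\<close> irrational.
  Hence, moving along a chain of integer vectors with non-zero consecutive symplectic products
  that spans the space, the rational relations of \<open>x J v\<close> shrink to those satisfied by \<open>B\<close> in all
  directions, and by hypothesis there are none. From such a point Kronecker's theorem makes every
  \<open>y\<close> available at each step of the reversed chain, so \<open>X\<close> is everything.\<close>

section \<open>Integer vectors and rank-one matrices\<close>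

definition int_vec :: "(real ^ 'n) set" where
  "int_vec = {v. \<forall>i. v $ i \<in> \<int>}"

definition outer :: "real ^ 'n \<Rightarrow> real ^ 'm \<Rightarrow> real ^ 'm ^ 'n" where
  "outer a v = (\<chi> i j. a $ i * v $ j)"

text \<open>The preimage in \<open>real ^ 'n\<close> of the closed subgroup of the torus generated
  by the class of \<open>w\<close> modulo integer vectors.\<close>

definition cyclic_closure :: "real ^ 'n \<Rightarrow> (real ^ 'n) set" where
  "cyclic_closure w = closure {of_int t *\<^sub>R w + z | t z. z \<in> int_vec}"

lemma int_vec_add: "u \<in> int_vec \<Longrightarrow> v \<in> int_vec \<Longrightarrow> u + v \<in> int_vec"
  and int_vec_0: "0 \<in> int_vec"
  and int_vec_axis: "axis j 1 \<in> int_vec"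
  by (auto simp: int_vec_def axis_def)

lemma inner_int_vec: "u \<in> int_vec \<Longrightarrow> v \<in> int_vec \<Longrightarrow> u \<bullet> v \<in> \<int>"
  by (auto simp: int_vec_def inner_vec_def intro!: Ints_sum)

lemma countable_int_vec: "countable (int_vec :: (real ^ 'n) set)"
proof -
  have "int_vec \<subseteq> range (\<lambda>f :: int ^ 'n. \<chi> i. real_of_int (f $ i))"
  proof
    fix v :: "real ^ 'n" assume "v \<in> int_vec"
    then have "v = (\<chi> i. real_of_int ((\<chi> i. \<lfloor>v $ i\<rfloor>) $ i))"
      by (auto simp: int_vec_def vec_eq_iff)
    then show "v \<in> range (\<lambda>f :: int ^ 'n. \<chi> i. real_of_int (f $ i))" by blast
  qed
  moreover have "countable (UNIV :: (int ^ 'n) set)"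
  proof -
    have "countable (UNIV :: ('n \<Rightarrow> int) set)" by simp
    then have "countable (range (vec_lambda :: ('n \<Rightarrow> int) \<Rightarrow> _))" by blast
    moreover have "range (vec_lambda :: ('n \<Rightarrow> int) \<Rightarrow> _) = UNIV"
      by (metis surjI vec_nth_inverse)
    ultimately show ?thesis by simp
  qed
  ultimately show ?thesis
    by (meson countable_image countable_subset)
qed

lemma outer_add_left: "outer (a + b) v = outer a v + outer b v"
  and outer_0_left: "outer 0 v = 0"
  by (auto simp: outer_def vec_eq_iff algebra_simps)

lemma outer_scaleR_left: "outer (r *\<^sub>R a) v = r *\<^sub>R outer a v"
  by (auto simp: outer_def vec_eq_iff algebra_simps)

lemma outer_int_vec: "a \<in> int_vec \<Longrightarrow> v \<in> int_vec \<Longrightarrow> outer a v $ i $ j \<in> \<int>"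
  by (simp add: outer_def int_vec_def)

lemma outer_mult_vec: "outer a v *v u = (v \<bullet> u) *\<^sub>R a"
  by (auto simp: outer_def vec_eq_iff matrix_vector_mult_def inner_vec_def sum_distrib_left
      sum_distrib_right algebra_simps)

lemma linear_outer: "linear (\<lambda>a. outer a v)"
  by (auto intro!: linearI simp: outer_add_left outer_scaleR_left)

lemma continuous_on_outer: "continuous_on S (\<lambda>a. outer a v)"
  by (rule linear_continuous_on) (rule linear_linear [THEN iffD2], rule linear_outer)

lemma matrix_eq_sum_outer:
  fixes D :: "real ^ 'm ^ 'n"
  shows "D = (\<Sum>j\<in>UNIV. outer (column j D) (axis j 1))"
  by (auto simp: vec_eq_iff outer_def column_def axis_def if_distrib cong: if_cong)

lemma inner_skew_matrix:
  fixes J :: "real ^ 'm ^ 'm"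
  assumes "transpose J = - J"
  shows "v \<bullet> (J *v u) = - ((J *v v) \<bullet> u)"
proof -
  have "v \<bullet> (J *v u) = (transpose J *v v) \<bullet> u"
    by (simp add: dot_lmul_matrix)
  also have "transpose J *v v = - (J *v v)"
    unfolding assms by (simp add: matrix_vector_mult_def vec_eq_iff sum_negf)
  finally show ?thesis by simp
qed

section \<open>Cyclic subgroups of the torus: Dirichlet, Baire and Kronecker\<close>

text \<open>Simultaneous Dirichlet approximation of the entries of \<open>w\<close>. A non-zero
  \<open>t\<close> is what matters: adding such a small vector to \<open>y\<close> changes
  \<open>c \<bullet> y\<close> whenever \<open>c\<close> is integral and
  \<open>c \<bullet> w\<close> is irrational.\<close>

lemma Dirichlet_small_multiple:
  fixes w :: "real ^ 'n"
  assumes "\<epsilon> > 0"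
  obtains t z where "t \<noteq> 0" "z \<in> int_vec" "norm (of_int t *\<^sub>R w + z) < \<epsilon>"
proof -
  define n where "n = CARD('n)"
  obtain h where h: "bij_betw h {0..<n} (UNIV :: 'n set)"
    using ex_bij_betw_nat_finite[of "UNIV :: 'n set"] unfolding n_def by auto
  \<comment> \<open>Each of the \<open>n\<close> entries may be off by \<open>1 / N\<close>, and the
    l1 bound below adds these errors up.\<close>
  obtain N :: nat where N: "N > 0" "1 / N < \<epsilon> / n"
  proof -
    have "\<epsilon> / n > 0" using assms by (simp add: n_def)
    then show ?thesis
      using that real_arch_inverse[of "\<epsilon> / n"] by (auto simp: inverse_eq_divide)
  qed
  obtain q p where q: "0 < q"
    and qp: "\<And>i. i < n \<Longrightarrow> \<bar>of_int q * (w $ h i) - of_int (p i)\<bar> < 1 / N"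
    using Dirichlet_approx_simult[OF N(1), where \<theta> = "\<lambda>i. w $ h i" and n = n] by metis
  define z :: "real ^ 'n" where "z = (\<chi> k. - of_int (p (inv_into {0..<n} h k)))"
  have entry: "\<bar>(of_int q *\<^sub>R w + z) $ k\<bar> < 1 / N" for k
  proof -
    have "k \<in> h ` {0..<n}" using h by (simp add: bij_betw_def)
    then have "inv_into {0..<n} h k \<in> {0..<n}" and "h (inv_into {0..<n} h k) = k"
      by (auto simp: f_inv_into_f simp del: atLeastLessThan_iff intro: inv_into_into)
    then show ?thesis using qp[of "inv_into {0..<n} h k"] by (simp add: z_def)
  qed
  have "norm (of_int q *\<^sub>R w + z) \<le> (\<Sum>k\<in>UNIV. \<bar>(of_int q *\<^sub>R w + z) $ k\<bar>)"
    by (rule norm_le_l1_cart)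
  also have "\<dots> \<le> (\<Sum>k\<in>(UNIV :: 'n set). 1 / N)"
    by (intro sum_mono less_imp_le entry)
  also have "\<dots> < \<epsilon>"
    using N by (simp add: n_def field_simps)
  finally show thesis
    using q by (intro that[of q z]) (auto simp: z_def int_vec_def)
qed

lemma closed_cyclic_closure: "closed (cyclic_closure w)"
  by (simp add: cyclic_closure_def)

lemma cyclic_closure_translate:
  fixes w :: "real ^ 'n"
  assumes "y \<in> cyclic_closure w" "z \<in> int_vec"
  shows "y + (of_int t *\<^sub>R w + z) \<in> cyclic_closure w"
proof -
  let ?S = "{of_int t *\<^sub>R w + z | t z. z \<in> int_vec}" and ?u = "of_int t *\<^sub>R w + z"
  have "(\<lambda>y. ?u + y) ` ?S \<subseteq> ?S"
  proof clarify
    fix s and z' :: "real ^ 'n" assume "z' \<in> int_vec"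
    then show "\<exists>t' z''. ?u + (of_int s *\<^sub>R w + z') = of_int t' *\<^sub>R w + z'' \<and> z'' \<in> int_vec"
      using assms(2)
      by (intro exI[of _ "t + s"] exI[of _ "z + z'"]) (auto simp: algebra_simps int_vec_add)
  qed
  then have "closure ((\<lambda>y. ?u + y) ` ?S) \<subseteq> closure ?S" by (rule closure_mono)
  then show ?thesis
    using assms(1) unfolding closure_translation cyclic_closure_def by (auto simp: add.commute)
qed

text \<open>Rationality is not a closed condition, but a fixed denominator is: if \<open>b\<close>
  is a denominator of \<open>c \<bullet> w\<close>, the generating group satisfies
  \<open>of_int b * (c \<bullet> y) \<in> \<int>\<close>, which passes to the closure.\<close>

lemma cyclic_closure_rational:
  assumes "c \<in> int_vec" "c \<bullet> w \<in> \<rat>" "y \<in> cyclic_closure w"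
  shows "c \<bullet> y \<in> \<rat>"
proof -
  obtain a b where b: "b > 0" and ab: "c \<bullet> w = of_int a / of_int b"
    using assms(2) by (meson Rats_cases')
  have "{of_int t *\<^sub>R w + z | t z. z \<in> int_vec} \<subseteq> (\<lambda>y. of_int b * (c \<bullet> y)) -` \<int>"
    using b assms(1)
    by (auto simp: inner_add_right ab distrib_left intro!: Ints_add Ints_mult inner_int_vec)
  moreover have "closed ((\<lambda>y. of_int b * (c \<bullet> y)) -` \<int>)"
    by (intro closed_vimage closed_Ints continuous_intros)
  ultimately have "cyclic_closure w \<subseteq> (\<lambda>y. of_int b * (c \<bullet> y)) -` \<int>"
    unfolding cyclic_closure_def by (rule closure_minimal)
  then have "of_int b * (c \<bullet> y) \<in> \<int>" using assms(3) by auto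
  then obtain k where "of_int b * (c \<bullet> y) = of_int k" by (auto elim: Ints_cases)
  then have "c \<bullet> y = of_int k / of_int b" using b by (simp add: field_simps)
  then show ?thesis by simp
qed

text \<open>Baire's theorem in the closed set \<open>cyclic_closure w\<close>: each pair in
  \<open>P\<close> removes a hyperplane, whose complement is relatively open. It is dense because a
  point on the hyperplane is pushed off by an arbitrarily small
  \<open>of_int t *\<^sub>R w + z\<close> with \<open>t \<noteq> 0\<close>.\<close>

lemma generic_dense_cyclic_closure:
  fixes w :: "real ^ 'n"
  assumes "countable P" and P: "\<And>c d. (c, d) \<in> P \<Longrightarrow> c \<in> int_vec \<and> c \<bullet> w \<notin> \<rat>"
  shows "cyclic_closure w \<subseteq> closure {y \<in> cyclic_closure w. \<forall>(c, d) \<in> P. c \<bullet> y \<noteq> d}"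
proof -
  let ?G = "cyclic_closure w"
  define U where "U = (\<lambda>(c, d). {y \<in> ?G. c \<bullet> y \<noteq> (d :: real)})"
  have "?G \<subseteq> closure (\<Inter>(insert ?G (U ` P)))"
  proof (rule Baire[OF closed_cyclic_closure])
    show "countable (insert ?G (U ` P))" using assms(1) by simp
    fix T assume "T \<in> insert ?G (U ` P)"
    then consider "T = ?G" | c d where "(c, d) \<in> P" "T = U (c, d)" by auto
    then show "openin (top_of_set ?G) T \<and> ?G \<subseteq> closure T"
    proof cases
      case 1 then show ?thesis by (simp add: closure_subset)
    next
      case (2 c d)
      have "open {y. c \<bullet> y \<noteq> d}"
        by (intro open_Collect_neq continuous_intros)
      then have "openin (top_of_set ?G) (U (c, d))"
        by (auto simp: U_def openin_open)
      moreover have "y \<in> closure (U (c, d))" if y: "y \<in> ?G" for y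
      proof (cases "c \<bullet> y = d")
        case False
        then show ?thesis using y by (intro subsetD[OF closure_subset]) (auto simp: U_def)
      next
        case True
        show ?thesis
          unfolding closure_approachable
        proof (intro allI impI)
          fix e :: real assume "e > 0"
          then obtain t z where t: "t \<noteq> 0" and z: "z \<in> int_vec"
            and small: "norm (of_int t *\<^sub>R w + z) < e"
            by (rule Dirichlet_small_multiple[of e w])
          have "c \<bullet> (of_int t *\<^sub>R w + z) \<noteq> 0"
          proof
            assume "c \<bullet> (of_int t *\<^sub>R w + z) = 0"
            then have "c \<bullet> w = - (c \<bullet> z) / of_int t"
              using t by (simp add: inner_add_right field_simps eq_neg_iff_add_eq_0)
            moreover have "c \<bullet> z \<in> \<rat>"
              using inner_int_vec[of c z] P 2 z Ints_subset_Rats by blast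
            ultimately show False using P[of c d] 2 by auto
          qed
          then have "y + (of_int t *\<^sub>R w + z) \<in> U (c, d)"
            using cyclic_closure_translate[OF y z] True by (auto simp: U_def inner_add_right)
          then show "\<exists>y'\<in>U (c, d). dist y' y < e"
            using small by (intro bexI[of _ "y + (of_int t *\<^sub>R w + z)"]) (auto simp: dist_norm)
        qed
      qed
      ultimately show ?thesis using 2 by auto
    qed
  qed
  also have "\<Inter>(insert ?G (U ` P)) = {y \<in> ?G. \<forall>(c, d) \<in> P. c \<bullet> y \<noteq> d}"
    by (auto simp: U_def)
  finally show ?thesis .
qed

text \<open>Kronecker's theorem: the assumption amounts to 1 and the entries of \<open>w\<close>
  satisfying no non-trivial integer relation.\<close>

lemma cyclic_closure_eq_UNIV:
  fixes w :: "real ^ 'n"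
  assumes irr: "\<And>c. c \<in> int_vec \<Longrightarrow> c \<bullet> w \<in> \<rat> \<Longrightarrow> c = 0"
  shows "cyclic_closure w = UNIV"
proof -
  define n where "n = CARD('n)"
  obtain h where h: "bij_betw h {0..<n} (UNIV :: 'n set)"
    using ex_bij_betw_nat_finite[of "UNIV :: 'n set"] unfolding n_def by auto
  define g where "g = inv_into {0..<n} h"
  have g: "g k < n" "h (g k) = k" for k
    using h inv_into_into[of k h "{0..<n}"] by (auto simp: g_def bij_betw_def f_inv_into_f)
  have gh: "g (h i) = i" if "i < n" for i
    using h that by (auto simp: g_def bij_betw_def inv_into_f_f)
  \<comment> \<open>The constant 1 is appended at index \<open>n\<close>, so that integer relations
    of \<open>\<theta>\<close> are relations of \<open>w\<close> modulo integers.\<close>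
  define \<theta> where "\<theta> i = (if i < n then w $ h i else 1)" for i
  have \<theta>g: "\<theta> (g k) = w $ k" for k using g by (simp add: \<theta>_def)
  have relation: "(\<forall>i\<le>n. u i = 0)" if "(\<Sum>i\<le>n. of_int (u i) * \<theta> i) = 0" for u :: "nat \<Rightarrow> int"
  proof -
    define c :: "real ^ 'n" where "c = (\<chi> k. of_int (u (g k)))"
    have "c \<bullet> w = (\<Sum>k\<in>UNIV. of_int (u (g k)) * w $ k)"
      by (simp add: c_def inner_vec_def)
    also have "\<dots> = (\<Sum>i\<in>{0..<n}. of_int (u i) * \<theta> i)"
      by (rule sum.reindex_bij_betw[OF h, symmetric, THEN trans])
        (auto simp: gh \<theta>_def intro!: sum.cong)
    also have "\<dots> = - of_int (u n)"
      using that by (simp add: lessThan_Suc_atMost[symmetric] atLeast0LessThan \<theta>_def)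
    finally have cw: "c \<bullet> w = - of_int (u n)" .
    then have "c = 0" by (intro irr) (auto simp: c_def int_vec_def)
    then have "u i = 0" if "i < n" for i
      using gh[OF that] by (auto simp: c_def vec_eq_iff dest!: spec[of _ "h i"])
    moreover have "u n = 0" using cw \<open>c = 0\<close> by simp
    ultimately show ?thesis by (auto simp: le_less)
  qed
  have inj: "inj_on \<theta> {..n}"
  proof (rule inj_onI, rule ccontr)
    fix i j assume ij: "i \<in> {..n}" "j \<in> {..n}" "\<theta> i = \<theta> j" "i \<noteq> j"
    let ?u = "\<lambda>k. if k = i then 1 else if k = j then -1 else (0::int)"
    have "(\<Sum>k\<le>n. of_int (?u k) * \<theta> k) = (\<Sum>k\<in>{i,j}. of_int (?u k) * \<theta> k)"
      using ij by (intro sum.mono_neutral_right) auto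
    also have "\<dots> = 0" using ij by simp
    finally show False using relation[of ?u] ij by auto
  qed
  interpret Z: Modules.module "\<lambda>r x. real_of_int r * x"
    by (simp add: Modules.module.intro distrib_left mult.commute)
  have indep: "Z.independent (\<theta> ` {..n})"
    unfolding Z.dependent_explicit
  proof clarify
    fix T u v assume T: "finite T" "T \<subseteq> \<theta> ` {..n}" and "(\<Sum>v\<in>T. real_of_int (u v) * v) = 0"
      and v: "v \<in> T" "u v \<noteq> 0"
    define u' where "u' x = (if x \<in> T then u x else 0)" for x
    have "(\<Sum>i\<le>n. of_int (u' (\<theta> i)) * \<theta> i) = (\<Sum>x\<in>\<theta> ` {..n}. of_int (u' x) * x)"
      by (simp add: sum.reindex[OF inj])
    also have "\<dots> = (\<Sum>x\<in>T. of_int (u x) * x)"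
      using T by (intro sum.mono_neutral_cong_right) (auto simp: u'_def)
    also have "\<dots> = 0" by fact
    finally have "\<forall>i\<le>n. u' (\<theta> i) = 0" by (rule relation)
    moreover obtain i where "i \<le> n" "v = \<theta> i" using v T by auto
    ultimately show False using v by (auto simp: u'_def)
  qed
  have "y \<in> cyclic_closure w" for y :: "real ^ 'n"
    unfolding cyclic_closure_def closure_approachable
  proof (intro allI impI)
    fix e :: real assume "e > 0"
    then have "e / n > 0" by (simp add: n_def)
    then obtain k m where km: "\<And>i. i < n \<Longrightarrow> \<bar>of_int k * \<theta> i - of_int (m i) - y $ h i\<bar> < e / n"
      using Kronecker_thm_2[OF indep inj, of "e / n" "\<lambda>i. y $ h i"] by (auto simp: \<theta>_def)
    define z :: "real ^ 'n" where "z = (\<chi> k. - of_int (m (g k)))"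
    have "norm (of_int k *\<^sub>R w + z - y) \<le> (\<Sum>l\<in>UNIV. \<bar>(of_int k *\<^sub>R w + z - y) $ l\<bar>)"
      by (rule norm_le_l1_cart)
    also have "\<dots> < (\<Sum>l\<in>(UNIV :: 'n set). e / n)"
    proof (rule sum_strict_mono)
      fix l show "\<bar>(of_int k *\<^sub>R w + z - y) $ l\<bar> < e / n"
        using km[OF g(1)[of l]] g(2)[of l] by (simp add: z_def \<theta>g)
    qed auto
    also have "\<dots> = e" by (simp add: n_def)
    finally show "\<exists>x\<in>{of_int t *\<^sub>R w + z | t z. z \<in> int_vec}. dist x y < e"
      by (intro bexI[of _ "of_int k *\<^sub>R w + z"] CollectI exI[of _ k] exI[of _ z])
        (auto simp: dist_norm z_def int_vec_def)
  qed
  then show ?thesis by auto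
qed

section \<open>Closed sets invariant under transvections and integer translations\<close>

text \<open>\<open>X\<close> stands for the orbit closure after division by \<open>2 * pi\<close>.
  \<open>X_transvection\<close> is right multiplication by
  \<open>mat 1 + of_int t *\<^sub>R outer (J *v v) v\<close>.\<close>

locale transvection_invariant =
  fixes J :: "real ^ 'm ^ 'm" and X :: "(real ^ 'm ^ 'n) set"
  assumes J_int: "\<And>v. v \<in> int_vec \<Longrightarrow> J *v v \<in> int_vec"
    and tJ_int: "\<And>v. v \<in> int_vec \<Longrightarrow> transpose J *v v \<in> int_vec"
    and J_orth: "J ** transpose J = mat 1"
    and J_skew: "transpose J = - J"
    and X_closed: "closed X"
    and X_transvection:
      "\<And>x v t. x \<in> X \<Longrightarrow> v \<in> int_vec \<Longrightarrow> x + of_int t *\<^sub>R outer (x *v (J *v v)) v \<in> X"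
    and X_translation: "\<And>x z v. x \<in> X \<Longrightarrow> z \<in> int_vec \<Longrightarrow> v \<in> int_vec \<Longrightarrow> x + outer z v \<in> X"
begin

text \<open>Adding \<open>outer y v\<close> to \<open>x\<close> changes \<open>x *v (J *v u)\<close>
  by a multiple of \<open>y\<close>, and this multiple is non-zero exactly when
  \<open>linked v u\<close>.\<close>

definition linked :: "real ^ 'm \<Rightarrow> real ^ 'm \<Rightarrow> bool" where
  "linked u v \<longleftrightarrow> u \<bullet> (J *v v) \<noteq> 0"

text \<open>The characters of the torus that send the class of \<open>x *v (J *v v)\<close> to a
  torsion point. If only \<open>0\<close> is resonant, Kronecker's theorem makes every displacement
  along \<open>v\<close> available.\<close>

definition resonances :: "real ^ 'm ^ 'n \<Rightarrow> real ^ 'm \<Rightarrow> (real ^ 'n) set" where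
  "resonances x v = {c \<in> int_vec. c \<bullet> (x *v (J *v v)) \<in> \<rat>}"

lemma linked_sym: "linked u v \<Longrightarrow> linked v u"
  using inner_skew_matrix[OF J_skew, of u v] by (simp add: linked_def inner_commute)

lemma J_transpose_J: "J *v (transpose J *v v) = v"
  unfolding matrix_vector_mul_assoc J_orth by simp

text \<open>The witness \<open>transpose J *v u\<close> pairs with \<open>u\<close> to
  \<open>u \<bullet> u\<close>.\<close>

lemma linked_ex:
  assumes "u \<in> int_vec" "u \<noteq> 0"
  obtains a where "a \<in> int_vec" "linked u a"
proof (rule that[of "transpose J *v u"])
  show "linked u (transpose J *v u)"
    unfolding linked_def J_transpose_J using assms by simp
qed (rule tJ_int[OF assms(1)])

text \<open>Take a partner \<open>a\<close> of \<open>u\<close> and a partner \<open>b\<close> of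
  \<open>v\<close>. If neither serves alone, both cross products vanish and \<open>a + b\<close>
  serves.\<close>

lemma linked_connect:
  assumes u: "u \<in> int_vec" "u \<noteq> 0" and v: "v \<in> int_vec" "v \<noteq> 0"
  obtains w where "w \<in> int_vec" "linked u w" "linked w v"
proof -
  obtain a where a: "a \<in> int_vec" "linked u a" using u by (rule linked_ex)
  obtain b where b: "b \<in> int_vec" "linked b v" using v linked_ex linked_sym by metis
  consider "linked a v" | "linked u b" | "\<not> linked a v" "\<not> linked u b" by blast
  then show thesis
  proof cases
    case 3
    then have "linked u (a + b)" "linked (a + b) v"
      using a b by (auto simp: linked_def matrix_vector_right_distrib inner_add_left inner_add_right)
    then show ?thesis using that a b int_vec_add by blast
  qed (use that a b in blast)+
qed

text \<open>Each new vector is joined to the head of the chain through one intermediate vector,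
  supplied by \<open>linked_connect\<close>.\<close>

lemma linked_chain:
  assumes "finite S" "S \<subseteq> int_vec - {0}"
  shows "\<exists>vs. S \<subseteq> set vs \<and> set vs \<subseteq> int_vec - {0} \<and> successively linked vs"
  using assms
proof (induction S rule: finite_induct)
  case empty
  then show ?case by (intro exI[of _ "[]"]) simp
next
  case (insert u S)
  then obtain vs where vs: "S \<subseteq> set vs" "set vs \<subseteq> int_vec - {0}" "successively linked vs"
    by auto
  show ?case
  proof (cases vs)
    case Nil
    then show ?thesis using insert vs by (intro exI[of _ "[u]"]) auto
  next
    case (Cons v vs')
    then obtain w where w: "w \<in> int_vec" "linked u w" "linked w v"
      using linked_connect[of u v] insert.prems vs(2) by auto
    then have "w \<noteq> 0" by (auto simp: linked_def)
    then show ?thesis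
      using insert.prems vs w Cons by (intro exI[of _ "u # w # vs"]) auto
  qed
qed

text \<open>Powers of a transvection along \<open>v\<close> and integer translations realise all
  displacements \<open>of_int t *\<^sub>R ?w + z\<close>; closedness of \<open>X\<close> adds their
  limits.\<close>

lemma X_add_outer:
  assumes "x \<in> X" "v \<in> int_vec" "y \<in> cyclic_closure (x *v (J *v v))"
  shows "x + outer y v \<in> X"
proof -
  let ?w = "x *v (J *v v)"
  have "{of_int t *\<^sub>R ?w + z | t z. z \<in> int_vec} \<subseteq> (\<lambda>y. x + outer y v) -` X"
    using X_translation[OF X_transvection[OF assms(1,2)] _ assms(2)]
    by (auto simp: outer_add_left outer_scaleR_left add.assoc)
  moreover have "closed ((\<lambda>y. x + outer y v) -` X)"
    by (intro closed_vimage X_closed continuous_intros continuous_on_outer)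
  ultimately have "cyclic_closure ?w \<subseteq> (\<lambda>y. x + outer y v) -` X"
    unfolding cyclic_closure_def by (rule closure_minimal)
  then show ?thesis using assms(3) by auto
qed

lemma inner_add_outer:
  "c \<bullet> ((x + outer y v) *v (J *v u)) = c \<bullet> (x *v (J *v u)) + (v \<bullet> (J *v u)) * (c \<bullet> y)"
  by (simp add: matrix_vector_mult_add_rdistrib outer_mult_vec inner_add_right)

text \<open>If \<open>c\<close> is not resonant at \<open>v\<close>, a generic \<open>y\<close>
  avoids the countably many values of \<open>c \<bullet> y\<close> that would make \<open>c\<close>
  resonant at \<open>v'\<close>.\<close>

lemma resonances_shrink_dense:
  fixes x :: "real ^ 'm ^ 'n"
  assumes "linked v v'"
  defines "G \<equiv> cyclic_closure (x *v (J *v v))"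
  shows "G \<subseteq> closure {y \<in> G. resonances (x + outer y v) v' \<subseteq> resonances x v}"
proof -
  \<comment> \<open>The second component is the value of \<open>c \<bullet> y\<close> for which the
    new pairing with \<open>v'\<close> equals \<open>q\<close>; \<open>linked v v'\<close> permits
    the division.\<close>
  let ?f = "\<lambda>(c, q). (c, (q - c \<bullet> (x *v (J *v v'))) / (v \<bullet> (J *v v')))"
  define P where "P = ?f ` ((int_vec - resonances x v) \<times> \<rat>)"
  have "countable P"
    unfolding P_def
    by (intro countable_image countable_SIGMA countable_Diff countable_int_vec countable_rat)
  then have "G \<subseteq> closure {y \<in> G. \<forall>(c, d) \<in> P. c \<bullet> y \<noteq> d}"
    unfolding G_def
    by (rule generic_dense_cyclic_closure) (auto simp: P_def resonances_def)
  also have "\<dots> \<subseteq> closure {y \<in> G. resonances (x + outer y v) v' \<subseteq> resonances x v}"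
  proof (rule closure_mono, clarify, rule ccontr)
    fix y c assume P: "\<forall>(c, d) \<in> P. c \<bullet> y \<noteq> d" and c: "c \<in> resonances (x + outer y v) v'"
      and nc: "c \<notin> resonances x v"
    let ?q = "c \<bullet> ((x + outer y v) *v (J *v v'))"
    have "?f (c, ?q) \<in> P"
      unfolding P_def using c nc by (intro imageI) (auto simp: resonances_def)
    moreover have "?f (c, ?q) = (c, c \<bullet> y)"
      using assms(1) by (simp add: inner_add_outer linked_def)
    ultimately show False using P by fastforce
  qed
  finally show ?thesis .
qed

text \<open>First pass along the chain: a generic displacement at each step confines the resonances
  at the next vector, and resonances found later pull back to the starting point in every chain
  direction at once.\<close>

lemma resonances_along_chain:
  assumes "successively linked (v # vs)" "set (v # vs) \<subseteq> int_vec" "x \<in> X"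
  shows "\<exists>x'\<in>X. \<forall>u\<in>set (v # vs). resonances x' (last (v # vs)) \<subseteq> resonances x u"
  using assms
proof (induction vs arbitrary: v x)
  case Nil
  then show ?case by auto
next
  case (Cons v' vs)
  let ?G = "cyclic_closure (x *v (J *v v))"
  \<comment> \<open>\<open>?G\<close> is non-empty, hence so is its dense subset of good
    displacements.\<close>
  have "x *v (J *v v) \<in> ?G"
    unfolding cyclic_closure_def
    by (rule subsetD[OF closure_subset], rule CollectI, rule exI[of _ 1], rule exI[of _ 0])
      (simp add: int_vec_0)
  moreover have "linked v v'" using Cons.prems by simp
  ultimately have "{y \<in> ?G. resonances (x + outer y v) v' \<subseteq> resonances x v} \<noteq> {}"
    using resonances_shrink_dense[of v v' x] by force
  then obtain y where y: "y \<in> ?G" "resonances (x + outer y v) v' \<subseteq> resonances x v" by blast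
  let ?x = "x + outer y v"
  have "?x \<in> X" using Cons.prems y by (intro X_add_outer) auto
  then obtain x' where x': "x' \<in> X"
    "\<forall>u\<in>set (v' # vs). resonances x' (last (v' # vs)) \<subseteq> resonances ?x u"
    using Cons.IH[of v' ?x] Cons.prems by auto
  \<comment> \<open>The induction hypothesis speaks of the moved point \<open>?x\<close>. To return
    to \<open>x\<close>, note that \<open>c\<close> is resonant at \<open>v\<close>, so
    \<open>c \<bullet> y\<close> is rational and so is the correction term in
    \<open>inner_add_outer\<close>.\<close>
  have "c \<in> resonances x u" if u: "u \<in> set (v # v' # vs)" and c: "c \<in> resonances x' (last (v' # vs))"
    for u c
  proof -
    have cv: "c \<in> resonances x v" using x'(2) c y(2) by auto
    show ?thesis
    proof (cases "u = v")
      case False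
      then have u': "u \<in> set (v' # vs)" using u by auto
      have "c \<bullet> y \<in> \<rat>" using cv y(1) by (auto simp: resonances_def intro: cyclic_closure_rational)
      moreover have "v \<bullet> (J *v u) \<in> \<rat>"
      proof -
        have "v \<bullet> (J *v u) \<in> \<int>"
          using Cons.prems(2) u by (intro inner_int_vec J_int) auto
        then show ?thesis using Ints_subset_Rats by auto
      qed
      moreover have "c \<bullet> (?x *v (J *v u)) \<in> \<rat>"
        using x'(2) u' c by (auto simp: resonances_def)
      ultimately have "c \<bullet> (?x *v (J *v u)) - (v \<bullet> (J *v u)) * (c \<bullet> y) \<in> \<rat>"
        by (intro Rats_diff Rats_mult)
      then show ?thesis using cv by (simp add: inner_add_outer resonances_def)
    qed (use cv in simp)
  qed
  then show ?case using x'(1) by (intro bexI[of _ x']) auto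
qed

text \<open>Second pass: without non-zero resonances at \<open>v\<close> every \<open>y\<close> is
  available. Generic ones create none at the next vector, so the induction hypothesis applies; the
  others follow by density, since \<open>X\<close> is closed and the later displacements are kept
  fixed.\<close>

lemma X_add_outer_chain:
  assumes "successively linked (v # map snd ps)" "set (v # map snd ps) \<subseteq> int_vec"
    "x \<in> X" "resonances x v \<subseteq> {0}"
  shows "x + outer y v + sum_list (map (case_prod outer) ps) \<in> X"
  using assms
proof (induction ps arbitrary: v x y)
  case Nil
  then have "cyclic_closure (x *v (J *v v)) = UNIV"
    by (intro cyclic_closure_eq_UNIV) (auto simp: resonances_def)
  then show ?case using Nil.prems by (auto intro: X_add_outer)
next
  case (Cons p ps)
  obtain y' v' where p: "p = (y', v')" by (cases p)
  let ?G = "cyclic_closure (x *v (J *v v))"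
  let ?F = "\<lambda>y. x + outer y v + sum_list (map (case_prod outer) (p # ps))"
  have G: "?G = UNIV"
    using Cons.prems by (intro cyclic_closure_eq_UNIV) (auto simp: resonances_def)
  have "?F y \<in> X" if y: "resonances (x + outer y v) v' \<subseteq> resonances x v" for y
  proof -
    have "x + outer y v + outer y' v' + sum_list (map (case_prod outer) ps) \<in> X"
    proof (rule Cons.IH)
      show "x + outer y v \<in> X" using Cons.prems G by (intro X_add_outer) auto
    qed (use Cons.prems y p in auto)
    then show ?thesis by (simp add: p add.assoc)
  qed
  then have "{y \<in> ?G. resonances (x + outer y v) v' \<subseteq> resonances x v} \<subseteq> ?F -` X" by auto
  moreover have "closed (?F -` X)"
    by (intro closed_vimage X_closed continuous_intros continuous_on_outer)
  ultimately have "closure {y \<in> ?G. resonances (x + outer y v) v' \<subseteq> resonances x v} \<subseteq> ?F -` X"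
    by (rule closure_minimal)
  moreover have "linked v v'" using Cons.prems p by simp
  ultimately have "?G \<subseteq> ?F -` X" using resonances_shrink_dense[of v v' x] by blast
  then show ?case using G by blast
qed

text \<open>A chain may repeat a vector; its last occurrence carries the whole coefficient and the
  earlier ones carry zero.\<close>

lemma sum_outer_along_list:
  fixes f :: "real ^ 'm \<Rightarrow> real ^ 'n"
  shows "\<exists>ps. map snd ps = vs \<and> sum_list (map (case_prod outer) ps) = (\<Sum>u\<in>set vs. outer (f u) u)"
proof (induction vs)
  case (Cons v vs)
  then obtain ps where ps: "map snd ps = vs"
    "sum_list (map (case_prod outer) ps) = (\<Sum>u\<in>set vs. outer (f u) u)" by blast
  show ?case
  proof (cases "v \<in> set vs")
    case True
    then show ?thesis
      using ps by (intro exI[of _ "(0, v) # ps"]) (simp add: outer_0_left insert_absorb)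
  next
    case False
    then show ?thesis using ps by (intro exI[of _ "(f v, v) # ps"]) simp
  qed
qed simp

theorem X_eq_UNIV:
  assumes x: "x \<in> X"
    and irr: "\<And>c. c \<in> int_vec \<Longrightarrow> (\<forall>j. c \<bullet> column j x \<in> \<rat>) \<Longrightarrow> c = 0"
  shows "X = UNIV"
proof -
  \<comment> \<open>The first family serves to decompose \<open>A - x'\<close> by columns. The
    second detects the columns of \<open>x\<close>, because
    \<open>J *v (transpose J *v axis j 1)\<close> is \<open>axis j 1\<close>.\<close>
  let ?S = "range (\<lambda>j. axis j 1) \<union> range (\<lambda>j. transpose J *v axis j 1)"
  have "transpose J *v axis j 1 \<noteq> 0" for j
    using J_transpose_J[of "axis j 1"] by (auto simp: axis_eq_0_iff simp del: transpose_matrix_vector)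
  then have "?S \<subseteq> int_vec - {0}"
    by (auto simp: int_vec_axis tJ_int axis_eq_0_iff simp del: transpose_matrix_vector)
  then obtain vs where vs: "?S \<subseteq> set vs" "set vs \<subseteq> int_vec - {0}" "successively linked vs"
    using linked_chain[of ?S] by auto
  then have "vs \<noteq> []" by auto
  then obtain v vs' where vs_Cons: "vs = v # vs'" by (cases vs) auto
  \<comment> \<open>Reversal makes the second pass start at \<open>u\<close>, the end of the first
    pass, where \<open>x'\<close> will have no non-zero resonance.\<close>
  obtain u us where us: "rev vs = u # us" using \<open>vs \<noteq> []\<close> by (cases "rev vs") auto
  have last: "last vs = u" by (metis us hd_rev list.sel(1))
  obtain x' where x': "x' \<in> X" "\<forall>v\<in>set vs. resonances x' u \<subseteq> resonances x v"
    using resonances_along_chain[of v vs' x, folded vs_Cons] vs x last by blast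
  have "resonances x' u \<subseteq> {0}"
  proof
    fix c assume c: "c \<in> resonances x' u"
    have "c \<bullet> column j x \<in> \<rat>" for j
    proof -
      have "c \<in> resonances x (transpose J *v axis j 1)" using c x'(2) vs(1) by blast
      then show ?thesis
        unfolding resonances_def J_transpose_J by (simp add: matrix_vector_mult_basis)
    qed
    then show "c \<in> {0}" using irr c by (auto simp: resonances_def)
  qed
  moreover have "successively linked (rev vs)"
    unfolding successively_rev
    using vs(3) by (rule successively_mono) (auto intro: linked_sym)
  moreover have "set (rev vs) \<subseteq> int_vec" using vs(2) by auto
  ultimately have chain: "x' + outer y u + sum_list (map (case_prod outer) ps) \<in> X"
    if "map snd ps = us" for y ps
    using X_add_outer_chain[of u ps x' y] x'(1) us that by auto
  have "A \<in> X" for A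
  proof -
    \<comment> \<open>At \<open>axis j 1\<close> this is column \<open>j\<close> of
      \<open>A - x'\<close>; being zero elsewhere, it lets the column decomposition be written as a
      sum over the whole chain.\<close>
    define f where "f v = (if \<exists>j. v = axis j 1 then (A - x') *v v else 0)" for v
    have "A - x' = (\<Sum>j\<in>UNIV. outer (column j (A - x')) (axis j 1))"
      by (rule matrix_eq_sum_outer)
    also have "\<dots> = (\<Sum>v\<in>range (\<lambda>j. axis j 1). outer (f v) v)"
      by (subst sum.reindex) (auto simp: inj_on_def axis_eq_axis f_def matrix_vector_mult_basis)
    also have "\<dots> = (\<Sum>v\<in>set (rev vs). outer (f v) v)"
      using vs(1) by (intro sum.mono_neutral_left) (auto simp: f_def outer_0_left)
    finally have A: "A = x' + (\<Sum>v\<in>set (rev vs). outer (f v) v)" by (simp add: algebra_simps)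
    obtain qs where qs: "map snd qs = rev vs"
      "sum_list (map (case_prod outer) qs) = (\<Sum>v\<in>set (rev vs). outer (f v) v)"
      using sum_outer_along_list by blast
    then obtain y ps where "qs = (y, u) # ps" "map snd ps = us"
      using us by (cases qs) auto
    then show ?thesis using chain[of ps y] A qs(2) by (simp add: add.assoc)
  qed
  then show ?thesis by auto
qed

end

section \<open>Integral symplectic matrices and transvections\<close>

lemma map_matrix_mult_real: "real_matrix (A ** B) = real_matrix A ** real_matrix B"
  by (simp add: map_matrix_def matrix_matrix_mult_def vec_eq_iff)

lemma matrix_mult_add_left: "(A + B) ** C = A ** C + B ** (C :: real ^ 'm ^ 'n)"
  by (simp add: matrix_matrix_mult_def vec_eq_iff sum.distrib distrib_right)

lemma map_matrix_transpose_real: "real_matrix (transpose A) = transpose (real_matrix A)"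
  by (simp add: map_matrix_def transpose_def vec_eq_iff)

lemma real_matrix_inj: "real_matrix A = real_matrix B \<Longrightarrow> A = B"
  by (simp add: map_matrix_def vec_eq_iff)

lemma real_matrix_mult_int_vec: "v \<in> int_vec \<Longrightarrow> real_matrix A *v v \<in> int_vec"
  by (auto simp: int_vec_def map_matrix_def matrix_vector_mult_def intro!: Ints_sum)

text \<open>Both sides are compared on vectors. The terms linear in \<open>t\<close> cancel by
  skewness of \<open>J\<close>, and the quadratic one vanishes because
  \<open>v \<bullet> (J *v v) = 0\<close>.\<close>

lemma transvection_symplectic:
  fixes J :: "real ^ 'm ^ 'm"
  assumes "transpose J = - J"
  defines "T \<equiv> \<lambda>t v. mat 1 + t *\<^sub>R outer (J *v v) v"
  shows "T t v ** J ** transpose (T t v) = J"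
proof -
  note skew = inner_skew_matrix[OF assms(1)]
  have isotropic: "v \<bullet> (J *v v) = 0" using skew[of v v] by (simp add: inner_commute)
  then have isotropic': "(J *v v) \<bullet> v = 0" by (simp add: inner_commute)
  have T: "T t v *v u = u + (t * (v \<bullet> u)) *\<^sub>R (J *v v)" for u
    by (simp add: T_def matrix_vector_mult_add_rdistrib scaleR_matrix_vector_assoc[symmetric]
        outer_mult_vec)
  have "transpose (outer a v) = outer v a" for a v :: "real ^ 'm"
    by (simp add: outer_def transpose_def vec_eq_iff)
  then have "transpose (T t v) = mat 1 + t *\<^sub>R outer v (J *v v)"
    unfolding T_def by (simp add: transpose_def outer_def mat_def vec_eq_iff)
  then have tT: "transpose (T t v) *v u = u + (t * ((J *v v) \<bullet> u)) *\<^sub>R v" for u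
    by (simp add: matrix_vector_mult_add_rdistrib scaleR_matrix_vector_assoc[symmetric]
        outer_mult_vec)
  show ?thesis
    by (subst matrix_eq)
      (simp add: matrix_vector_mul_assoc[symmetric] T tT matrix_vector_right_distrib inner_add_right
        matrix_vector_mult_scaleR isotropic' skew[of v] del: transpose_matrix_vector)
qed

lemma symplectic_J_orth:
  "real_matrix symplectic_J ** transpose (real_matrix symplectic_J)
    = (mat 1 :: real ^ ('g::finite \<times> 2) ^ ('g \<times> 2))"
proof -
  have "(\<Sum>r\<in>UNIV. symplectic_J $ p $ r * symplectic_J $ q $ r) = (if p = q then 1 else 0)"
    for p q :: "'g \<times> 2"
  proof -
    have "(\<Sum>r\<in>UNIV. symplectic_J $ p $ r * symplectic_J $ q $ r) =
      (\<Sum>g\<in>UNIV. \<Sum>k\<in>UNIV. symplectic_J $ p $ (g, k) * symplectic_J $ q $ (g, k))"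
      by (simp add: UNIV_Times_UNIV[symmetric] sum.cartesian_product del: UNIV_Times_UNIV)
    also have "\<dots> = (\<Sum>g\<in>UNIV. if g = fst p then
        (\<Sum>k\<in>UNIV. symplectic_block $ snd p $ k * symplectic_J $ q $ (g, k)) else 0)"
      by (intro sum.cong) (auto simp: symplectic_J_def)
    also have "\<dots> = (\<Sum>k\<in>UNIV. symplectic_block $ snd p $ k * symplectic_J $ q $ (fst p, k))"
      by simp
    also have "\<dots> = (if p = q then 1 else 0)"
      using exhaust_2[of "snd p"] exhaust_2[of "snd q"]
      by (auto simp: symplectic_J_def symplectic_block_def sum_2 prod_eq_iff)
    finally show ?thesis .
  qed
  then show ?thesis
    by (simp add: map_matrix_def matrix_matrix_mult_def transpose_def mat_def vec_eq_iff
        of_int_mult[symmetric] of_int_sum[symmetric] del: of_int_mult of_int_sum)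
qed

lemma symplectic_J_skew:
  "transpose (real_matrix symplectic_J)
    = - (real_matrix symplectic_J :: real ^ ('g::finite \<times> 2) ^ ('g \<times> 2))"
proof -
  have "symplectic_J $ q $ p = - symplectic_J $ p $ q" for p q :: "'g \<times> 2"
    using exhaust_2[of "snd p"] exhaust_2[of "snd q"]
    by (auto simp: symplectic_J_def symplectic_block_def)
  then have skew: "real_of_int (symplectic_J $ q $ p) = - real_of_int (symplectic_J $ p $ q)"
    for p q :: "'g \<times> 2"
    by (metis of_int_minus)
  show ?thesis
    unfolding vec_eq_iff
  proof (intro allI)
    fix p q :: "'g \<times> 2"
    show "transpose (real_matrix symplectic_J) $ p $ q = (- real_matrix symplectic_J) $ p $ q"
      unfolding transpose_def map_matrix_def by (simp add: skew[of q p])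
  qed
qed

lemma real_matrix_ex:
  assumes "\<And>i j. M $ i $ j \<in> \<int>"
  obtains K where "M = real_matrix K"
  using assms
  by (intro that[of "\<chi> i j. \<lfloor>M $ i $ j\<rfloor>"]) (simp add: map_matrix_def vec_eq_iff)

lemma Sp_int_mult: "K \<in> Sp_int \<Longrightarrow> L \<in> Sp_int \<Longrightarrow> K ** L \<in> Sp_int"
  by (simp add: Sp_int_def matrix_transpose_mul) (metis matrix_mul_assoc)

section \<open>Comparison of an arbitrary norm with the Euclidean one\<close>

lemma is_norm_le_norm:
  fixes N :: "'a::euclidean_space \<Rightarrow> real"
  assumes "is_norm N"
  obtains B where "B > 0" "\<And>x. N x \<le> B * norm x"
proof -
  \<comment> \<open>The summand 1 makes the bound strictly positive.\<close>
  define B where "B = 1 + (\<Sum>b\<in>Basis. N b)"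
  have N: "N (c *\<^sub>R x) = \<bar>c\<bar> * N x" "N (x + y) \<le> N x + N y" "N x \<ge> 0" for c x y
    using assms by (auto simp: is_norm_def)
  have N0: "N 0 = 0" using assms by (simp add: is_norm_def)
  have N_sum: "N (sum f S) \<le> (\<Sum>b\<in>S. N (f b))" if "finite S" for f :: "'a \<Rightarrow> 'a" and S
    using that
  proof induction
    case (insert b S)
    then show ?case using N(2)[of "f b" "sum f S"] by simp
  qed (simp add: N0)
  have "N x \<le> B * norm x" for x
  proof -
    have "N x = N (\<Sum>b\<in>Basis. (x \<bullet> b) *\<^sub>R b)" by (simp add: euclidean_representation)
    also have "\<dots> \<le> (\<Sum>b\<in>Basis. N ((x \<bullet> b) *\<^sub>R b))" by (rule N_sum) simp
    also have "\<dots> \<le> (\<Sum>b\<in>Basis. norm x * N b)"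
      by (intro sum_mono) (simp add: N mult_right_mono Basis_le_norm)
    also have "\<dots> = norm x * (\<Sum>b\<in>Basis. N b)" by (rule sum_distrib_left[symmetric])
    also have "\<dots> \<le> B * norm x" by (simp add: B_def mult.commute mult_left_mono)
    finally show ?thesis .
  qed
  moreover have "B > 0" using sum_nonneg[of Basis N] N(3) by (simp add: B_def add_pos_nonneg)
  ultimately show thesis using that by blast
qed

section \<open>Density of the symplectic orbit\<close>

text \<open>Rational values \<open>r j\<close> of \<open>c\<close> on the rescaled columns assemble
  into one rational relation between the \<open>b i\<close> and the vectors
  \<open>pi *\<^sub>R axis j 1\<close>, so its coefficients vanish.\<close>

lemma rat_independent_no_resonance:
  fixes b :: "'n::finite \<Rightarrow> real ^ 'm"
  assumes indep: "rat_independent_family (case_sum b (\<lambda>j :: 'm. pi *\<^sub>R axis j 1))"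
    and c: "c \<in> int_vec" "\<forall>j. c \<bullet> column j ((1 / (2 * pi)) *\<^sub>R (\<chi> i. b i)) \<in> \<rat>"
  shows "c = 0"
proof -
  obtain r where r: "\<And>j. c \<bullet> column j ((1 / (2 * pi)) *\<^sub>R (\<chi> i. b i)) = of_rat (r j)"
    using c(2) unfolding Rats_def image_iff by metis
  obtain d where d: "\<And>i. c $ i = of_int (d i)"
    using c(1) unfolding int_vec_def Ints_def image_iff by (auto, metis)
  \<comment> \<open>The factor 2 arises because the columns are divided by \<open>2 * pi\<close>
    while the family contains multiples of \<open>pi\<close>.\<close>
  let ?q = "case_sum (\<lambda>i. of_int (d i)) (\<lambda>j. - 2 * r j)"
  have "(\<Sum>k\<in>UNIV. rat_scale (?q k) (case_sum b (\<lambda>j. pi *\<^sub>R axis j 1) k)) =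
    (\<Sum>i\<in>UNIV. c $ i *\<^sub>R b i) + (\<Sum>j\<in>UNIV. (- 2 * of_rat (r j) * pi) *\<^sub>R axis j 1)"
    unfolding UNIV_Plus_UNIV[symmetric]
    by (subst sum.Plus) (auto simp: rat_scale_def d of_rat_mult of_rat_minus)
  also have "\<dots> = 0"
  proof (subst vec_eq_iff, rule allI)
    fix j
    have "of_rat (r j) * (2 * pi) = (\<Sum>i\<in>UNIV. c $ i * b i $ j)"
      unfolding r[symmetric]
      by (simp add: inner_vec_def column_def sum_divide_distrib[symmetric])
    then show "((\<Sum>i\<in>UNIV. c $ i *\<^sub>R b i) + (\<Sum>j\<in>UNIV. (- 2 * of_rat (r j) * pi) *\<^sub>R axis j 1)) $ j
        = 0 $ j"
      by (simp add: axis_def if_distrib cong: if_cong)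
  qed
  finally have "\<forall>k. ?q k = 0"
    using indep unfolding rat_independent_family_iff by blast
  then have "d i = 0" for i by (auto dest!: spec[of _ "Inl i"])
  then show ?thesis by (simp add: d vec_eq_iff)
qed

lemma closure_invariant:
  assumes "continuous_on UNIV f" "\<And>x. x \<in> S \<Longrightarrow> f x \<in> S" "x \<in> closure S"
  shows "f x \<in> closure S"
proof -
  have "f ` closure S \<subseteq> closure S"
    using assms closure_subset
    by (intro image_closure_subset) (auto intro: continuous_on_subset)
  then show ?thesis using assms(3) by blast
qed

text \<open>Both operations are continuous and preserve the orbit, hence its closure: a translation
  changes only \<open>H\<close>, and a transvection is right multiplication by an integral
  symplectic \<open>L\<close>, sending \<open>K\<close> to \<open>K ** L\<close> and
  \<open>H\<close> to \<open>H ** L\<close>.\<close>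

lemma transvection_invariant_orbit_closure:
  fixes M :: "real ^ ('g::finite \<times> 2) ^ 'n::finite"
  shows "transvection_invariant (real_matrix symplectic_J)
    (closure {M ** real_matrix K + real_matrix H | K H. K \<in> Sp_int})"
proof
  let ?J = "real_matrix symplectic_J :: real ^ ('g \<times> 2) ^ ('g \<times> 2)"
  let ?S = "{M ** real_matrix K + real_matrix H | K H. K \<in> Sp_int}"
  show "?J *v v \<in> int_vec" "transpose ?J *v v \<in> int_vec" if "v \<in> int_vec" for v
    using that real_matrix_mult_int_vec by (auto simp: map_matrix_transpose_real[symmetric])
  show "?J ** transpose ?J = mat 1" by (rule symplectic_J_orth)
  show "transpose ?J = - ?J" by (rule symplectic_J_skew)
  show "closed (closure ?S)" by simp
  show "x + outer z v \<in> closure ?S"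
    if "x \<in> closure ?S" and zv: "z \<in> int_vec" "v \<in> int_vec" for x z v
  proof (rule closure_invariant[where f = "\<lambda>x. x + outer z v", OF _ _ that(1)])
    have "outer z v $ i $ j \<in> \<int>" for i j using zv by (rule outer_int_vec)
    then obtain L where L: "outer z v = real_matrix L" by (rule real_matrix_ex)
    have "real_matrix H + real_matrix L = real_matrix (H + L)" for H
      by (simp add: map_matrix_def vec_eq_iff)
    then show "x + outer z v \<in> ?S" if "x \<in> ?S" for x
      using that unfolding L by (clarsimp simp: add.assoc) blast
  qed (intro continuous_intros)
  show "x + of_int t *\<^sub>R outer (x *v (?J *v v)) v \<in> closure ?S"
    if "x \<in> closure ?S" and v: "v \<in> int_vec" for x v t
  proof -
    define T where "T = mat 1 + of_int t *\<^sub>R outer (?J *v v) v"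
    have T: "x + of_int t *\<^sub>R outer (x *v (?J *v v)) v = x ** T" for x :: "real ^ ('g \<times> 2) ^ 'n"
    proof -
      have "x ** outer a v = outer (x *v a) v" for a
        by (simp add: outer_def matrix_matrix_mult_def matrix_vector_mult_def vec_eq_iff
            sum_distrib_right sum_distrib_left mult_ac)
      then show ?thesis
        by (simp add: T_def matrix_add_ldistrib matrix_scalar_ac scalar_matrix_assoc[symmetric])
    qed
    have Jv: "?J *v v \<in> int_vec" using v by (rule real_matrix_mult_int_vec)
    have "T $ i $ j \<in> \<int>" for i j
      using outer_int_vec[OF Jv v] by (auto simp: T_def mat_def)
    then obtain L where L: "T = real_matrix L" by (rule real_matrix_ex)
    have "L \<in> Sp_int"
      using transvection_symplectic[OF symplectic_J_skew, of "of_int t" v]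
      unfolding T_def[symmetric] L
      by (auto simp: Sp_int_def map_matrix_mult_real[symmetric] map_matrix_transpose_real[symmetric]
          intro: real_matrix_inj)
    show ?thesis
      unfolding T
    proof (rule closure_invariant[where f = "\<lambda>x. x ** T", OF _ _ that(1)])
      show "continuous_on UNIV (\<lambda>x :: real ^ ('g \<times> 2) ^ 'n. x ** T)"
        unfolding T[symmetric] outer_def matrix_vector_mult_def
        by (intro continuous_intros)
      fix x assume "x \<in> ?S"
      then obtain K H where "K \<in> Sp_int" and x: "x = M ** real_matrix K + real_matrix H" by blast
      then have "x ** T = M ** real_matrix (K ** L) + real_matrix (H ** L)" "K ** L \<in> Sp_int"
        using \<open>L \<in> Sp_int\<close>
        by (auto simp: L map_matrix_mult_real matrix_mult_add_left matrix_mul_assoc Sp_int_mult)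
      then show "x ** T \<in> ?S" by blast
    qed
  qed
qed

lemma Sp_int_orbit_dense:
  fixes b :: "'n::finite \<Rightarrow> real ^ ('g::finite \<times> 2)"
  assumes "rat_independent_family (case_sum b (\<lambda>j :: 'g \<times> 2. pi *\<^sub>R axis j 1))"
  shows "closure {((1 / (2 * pi)) *\<^sub>R (\<chi> i. b i)) ** real_matrix K + real_matrix H | K H. K \<in> Sp_int}
    = UNIV"
proof -
  let ?M = "(1 / (2 * pi)) *\<^sub>R (\<chi> i. b i)"
  let ?S = "{?M ** real_matrix K + real_matrix H | K H. K \<in> Sp_int}"
  interpret transvection_invariant "real_matrix symplectic_J" "closure ?S"
    by (rule transvection_invariant_orbit_closure)
  have "mat 1 \<in> Sp_int" by (simp add: Sp_int_def)
  then have "?M ** real_matrix (mat 1) + real_matrix 0 \<in> ?S" by blast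
  moreover have "?M ** real_matrix (mat 1) + real_matrix 0 = ?M"
  proof -
    have "real_matrix (mat 1 :: int ^ ('g \<times> 2) ^ ('g \<times> 2)) = mat 1"
      by (simp add: map_matrix_def mat_def vec_eq_iff)
    moreover have "real_matrix (0 :: int ^ ('g \<times> 2) ^ 'n) = 0"
      by (simp add: map_matrix_def vec_eq_iff)
    ultimately show ?thesis by simp
  qed
  ultimately have "?M \<in> ?S" by metis
  then have "?M \<in> closure ?S" by (rule subsetD[OF closure_subset])
  then show ?thesis
    by (rule X_eq_UNIV) (rule rat_independent_no_resonance[OF assms])
qed

text \<open>\<open>C = 1\<close> serves for all norms at once: the orbit is dense, so the precision
  can absorb the constant comparing \<open>N\<close> with the Euclidean norm.\<close>

theorem theorem3:
  shows "\<exists>C::real. C > 0 \<and>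
    (\<forall>N :: real ^ ('g::finite \<times> 2) ^ 'n::finite \<Rightarrow> real. is_norm N \<longrightarrow>
      (\<forall>b :: 'n \<Rightarrow> real ^ ('g \<times> 2).
        rat_independent_family (case_sum b (\<lambda>j :: 'g \<times> 2. pi *\<^sub>R axis j 1)) \<longrightarrow>
        (\<forall>(A :: real ^ ('g \<times> 2) ^ 'n) (\<epsilon>::real). \<epsilon> > 0 \<longrightarrow>
          (\<exists>K \<in> Sp_int. norm_less_mod_2pi N (A - (\<chi> i. b i) ** real_matrix K) (C * \<epsilon>)))))"
proof (intro exI[of _ 1] conjI allI impI)
  fix N :: "real ^ ('g \<times> 2) ^ 'n \<Rightarrow> real" and b :: "'n \<Rightarrow> real ^ ('g \<times> 2)"
    and A :: "real ^ ('g \<times> 2) ^ 'n" and \<epsilon> :: real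
  assume N: "is_norm N" and \<epsilon>: "\<epsilon> > 0"
    and b: "rat_independent_family (case_sum b (\<lambda>j :: 'g \<times> 2. pi *\<^sub>R axis j 1))"
  obtain D where D: "D > 0" "\<And>x. N x \<le> D * norm x" using is_norm_le_norm[OF N] by metis
  let ?M = "(1 / (2 * pi)) *\<^sub>R (\<chi> i. b i)"
  have "(1 / (2 * pi)) *\<^sub>R A \<in> closure {?M ** real_matrix K + real_matrix H | K H. K \<in> Sp_int}"
    using Sp_int_orbit_dense[OF b] by simp
  \<comment> \<open>Here \<open>2 * pi\<close> undoes the rescaling and \<open>D\<close> converts
    the Euclidean norm to \<open>N\<close>.\<close>
  moreover have "\<epsilon> / (2 * pi * D) > 0" using \<epsilon> D by simp
  ultimately obtain K H where K: "K \<in> Sp_int" and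
    close: "dist (?M ** real_matrix K + real_matrix H) ((1 / (2 * pi)) *\<^sub>R A) < \<epsilon> / (2 * pi * D)"
    unfolding closure_approachable by blast
  let ?R = "A - (\<chi> i. b i) ** real_matrix K - (2 * pi) *\<^sub>R real_matrix H"
  have "?M ** real_matrix K = (1 / (2 * pi)) *\<^sub>R ((\<chi> i. b i) ** real_matrix K)"
    by (simp add: scalar_matrix_assoc)
  then have "?R = (2 * pi) *\<^sub>R ((1 / (2 * pi)) *\<^sub>R A - (?M ** real_matrix K + real_matrix H))"
    by (simp add: algebra_simps)
  then have "norm ?R = 2 * pi * dist (?M ** real_matrix K + real_matrix H) ((1 / (2 * pi)) *\<^sub>R A)"
    by (simp add: dist_norm norm_minus_commute)
  then have "D * norm ?R < \<epsilon>" using close D(1) by (simp add: field_simps)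
  then have "N ?R < 1 * \<epsilon>" using D(2)[of ?R] by simp
  then show "\<exists>K \<in> Sp_int. norm_less_mod_2pi N (A - (\<chi> i. b i) ** real_matrix K) (1 * \<epsilon>)"
    using K unfolding norm_less_mod_2pi_def by blast
qed simp

end
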